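(* Let $\Lambda=\{\lambda_n\}_{n\ge 0}$ be a sequence of real numbers with $\lambda_0=1$, and let $n\ge 1$ be a natural number. Then $$V_n[\Lambda]=T_n[\Lambda]\,\bigl([1]\oplus V_{n-1}[\Lambda]\bigr),$$ where $\oplus$ denotes the direct sum (block-diagonal sum) of two matrices and $[1]$ is the $1\times 1$ identity matrix.
   Context: Rows and columns of matrices are indexed from $0$. Given a sequence $\Lambda=\{\lambda_n\}_{n\ge0}$, define numbers $a_{i,j}$ ($i,j\ge 0$) by $a_{i,0}=\lambda_i$ for $i\ge 0$, $a_{i,j}=0$ for $i<j$, and $$a_{i,j}=\sum_{l=j-1}^{i-1}\lambda_{i-1-l}\,a_{l,j-1}\qquad (i\ge j\ge 1).$$ The vertically-recurrent matrix associated with $\Lambda$, of order $(n+1)\times(n+1)$, is $V_n[\Lambda]=[a_{i,j}]_{0\le i,j\le n}$. The lower triangular Toeplitz matrix $T_n[\Lambda]$ is the $(n+1)\times(n+1)$ matrix whose $(i,j)$ entry is $\lambda_{i-j}$ if $i\ge j$ and $0$ if $i<j$ ($0\le i,j\le n$). *)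

theory Defs
  imports Complex_Main "Jordan_Normal_Form.Matrix"
begin

(* In the second equation j stands for the column index minus one. *)
fun vr_entry :: "(nat \<Rightarrow> real) \<Rightarrow> nat \<Rightarrow> nat \<Rightarrow> real" where
  "vr_entry \<Lambda> i 0 = \<Lambda> i"
| "vr_entry \<Lambda> i (Suc j) =
     (if i < Suc j then 0 else (\<Sum>l = j..i - 1. \<Lambda> (i - 1 - l) * vr_entry \<Lambda> l j))"

(* The parameter n of both matrices is the largest index: their order is n + 1. *)
definition vr_mat :: "nat \<Rightarrow> (nat \<Rightarrow> real) \<Rightarrow> real mat" where
  "vr_mat n \<Lambda> = mat (n + 1) (n + 1) (\<lambda>(i, j). vr_entry \<Lambda> i j)"

definition lt_toeplitz_mat :: "nat \<Rightarrow> (nat \<Rightarrow> real) \<Rightarrow> real mat" where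
  "lt_toeplitz_mat n \<Lambda> = mat (n + 1) (n + 1) (\<lambda>(i, j). if i \<ge> j then \<Lambda> (i - j) else 0)"

end

theory Submission
  imports Defs
begin

text \<open>Multiplying by a lower triangular Toeplitz matrix convolves each column with \<Lambda>.
  Column 0 of the direct sum is the first unit vector, so it yields \<Lambda> itself. Any later
  column j is column j - 1 of the smaller matrix pushed down one place below a 0, and its
  convolution with \<Lambda> is the defining recurrence, in the form
  \<open>vr_entry_Suc_Suc\<close>.\<close>

lemma vr_entry_eq_0: "i < j \<Longrightarrow> vr_entry \<Lambda> i j = 0"
  by (cases j) auto

text \<open>Entries above the diagonal vanish, so the sum may start at 0 instead of j. This also
  absorbs the case i < j, where every term is 0.\<close>

lemma vr_entry_Suc_Suc:
  "vr_entry \<Lambda> (Suc i) (Suc j) = (\<Sum>l\<le>i. \<Lambda> (i - l) * vr_entry \<Lambda> l j)"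
proof -
  have "(\<Sum>l\<le>i. \<Lambda> (i - l) * vr_entry \<Lambda> l j) = (\<Sum>l = j..i. \<Lambda> (i - l) * vr_entry \<Lambda> l j)"
    by (rule sum.mono_neutral_right) (auto simp: vr_entry_eq_0)
  then show ?thesis
    by simp
qed

lemma diag_block_mat_one_index:
  assumes "A \<in> carrier_mat m m" "i \<le> m" "j \<le> m"
  shows "diag_block_mat [1\<^sub>m 1, A] $$ (i, j) =
    (if i = 0 then if j = 0 then 1 else 0 else if j = 0 then 0 else A $$ (i - 1, j - 1))"
  using assms by (auto simp: Let_def)

theorem theorem2p4:
  fixes \<Lambda> :: "nat \<Rightarrow> real" and n :: nat
  assumes "\<Lambda> 0 = 1" and "n \<ge> 1"
  shows "vr_mat n \<Lambda> = lt_toeplitz_mat n \<Lambda> * diag_block_mat [1\<^sub>m 1, vr_mat (n - 1) \<Lambda>]"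
proof -
  define T where "T = lt_toeplitz_mat n \<Lambda>"
  define D where "D = diag_block_mat [1\<^sub>m 1, vr_mat (n - 1) \<Lambda>]"
  \<comment> \<open>The order is n - 1 + 1, which equals n in truncated subtraction because n \<ge>
    1.\<close>
  have V: "vr_mat (n - 1) \<Lambda> \<in> carrier_mat n n"
    using assms(2) by (simp add: vr_mat_def)
  then have D: "dim_row D = n + 1" "dim_col D = n + 1"
    by (auto simp: D_def Let_def)
  note D_index = diag_block_mat_one_index[OF V, folded D_def]
  have "vr_mat n \<Lambda> = T * D"
  proof (rule eq_matI)
    show "dim_row (vr_mat n \<Lambda>) = dim_row (T * D)" "dim_col (vr_mat n \<Lambda>) = dim_col (T * D)"
      using D by (simp_all add: vr_mat_def T_def lt_toeplitz_mat_def)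
    fix i j assume "i < dim_row (T * D)" "j < dim_col (T * D)"
    then have ij: "i \<le> n" "j \<le> n"
      using D by (simp_all add: T_def lt_toeplitz_mat_def)
    have "(T * D) $$ (i, j) = (\<Sum>k<n+1. T $$ (i, k) * D $$ (k, j))"
      using ij D by (simp add: T_def lt_toeplitz_mat_def scalar_prod_def atLeast0LessThan)
    \<comment> \<open>The terms with k > i drop out since T is lower triangular.\<close>
    also have "\<dots> = (\<Sum>k\<le>i. \<Lambda> (i - k) * D $$ (k, j))"
      using ij by (intro sum.mono_neutral_cong_right) (auto simp: T_def lt_toeplitz_mat_def)
    also have "\<dots> = vr_entry \<Lambda> i j"
    proof (cases j)
      case 0
      have "(\<Sum>k\<le>i. \<Lambda> (i - k) * D $$ (k, j)) = (\<Sum>k\<le>i. if k = 0 then \<Lambda> i else 0)"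
        using ij 0 by (intro sum.cong) (auto simp: D_index)
      then show ?thesis
        using 0 by simp
    next
      case (Suc j')
      have D_0: "D $$ (0, j) = 0"
        using ij Suc by (simp add: D_index)
      show ?thesis
      proof (cases i)
        case 0
        then show ?thesis
          using Suc D_0 by simp
      next
        case (Suc i')
        \<comment> \<open>The bound gives k < n, so the entry lies inside the smaller block.\<close>
        have "D $$ (Suc k, j) = vr_entry \<Lambda> k j'" if "k \<le> i'" for k
          using that ij Suc \<open>j = Suc j'\<close>
          by (simp add: D_index vr_mat_def)
        \<comment> \<open>Splitting off k = 0, which contributes 0 by \<open>D_0\<close>, and
          shifting the index leaves the sum of \<open>vr_entry_Suc_Suc\<close>.\<close>
        then show ?thesis
          using D_0 Suc \<open>j = Suc j'\<close>
          by (simp add: sum.atMost_Suc_shift vr_entry_Suc_Suc del: sum.atMost_Suc vr_entry.simps)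
      qed
    qed
    also have "\<dots> = vr_mat n \<Lambda> $$ (i, j)"
      using ij by (simp add: vr_mat_def)
    finally show "vr_mat n \<Lambda> $$ (i, j) = (T * D) $$ (i, j)"
      by simp
  qed
  then show ?thesis
    by (simp only: T_def D_def)
qed

end
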